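(* Let $(X,b)$ be a connected weighted graph with $\mathrm{diam}_d(X)<\infty$. Then the following three (mutually equivalent) conditions are satisfied: (i) there exists $c>0$ with $\|f\|_{\mathcal V}^2\le c\,\mathcal E(f)$ for all $f\in\mathcal D$; (ii) $\mathcal D\subset\ell^\infty(X)$; (iii) $\mathrm{diam}_r(X)<\infty$. Moreover, for any probability measure $m$ on $X$ of full support, the second lowest eigenvalue $\lambda_1$ of $H_m^{(N)}$ is bounded below by $$\lambda_1\ge\frac{4}{\mathrm{diam}_d(X)}.$$
   Context: A weighted graph $(X,b)$ consists of a nonempty countable (finite or infinite) set $X$ and a symmetric function $b:X\times X\to[0,\infty)$ with $b(x,x)=0$ for all $x\in X$ (no summability or local finiteness is assumed). A path from $x$ to $y$ is a finite sequence $\gamma=(x_0,\dots,x_k)$ with $x_0=x$, $x_k=y$ and $b(x_j,x_{j+1})>0$ for $0\le j<k$; its length is $L(\gamma)=\sum_{j=0}^{k-1}1/b(x_j,x_{j+1})$; trivial paths from $x$ to $x$ of length $0$ are allowed. The graph is connected if any two points are joined by a path. Put $d(x,y)=\inf\{L(\gamma)\mid\gamma\text{ a path from }x\text{ to }y\}$. Let $\mathcal D=\{f:X\to\mathbb R\mid \sum_{x,y\in X}b(x,y)|f(x)-f(y)|^2<\infty\}$ and $\mathcal E(f,g)=\frac12\sum_{x,y\in X}b(x,y)(f(x)-f(y))(g(x)-g(y))$, $\mathcal E(f)=\mathcal E(f,f)$. For $f:X\to\mathbb R$ put $\|f\|_{\mathcal V}=\sup f-\inf f\in[0,\infty]$;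 $\ell^\infty(X)$ is the set of bounded real functions. $r(x,y)=\sup\{|f(x)-f(y)|^2\mid f\in\mathcal D,\ \mathcal E(f)\le1\}$. For $\delta\in\{d,r\}$, $\mathrm{diam}_\delta(X)=\sup_{x,y}\delta(x,y)$. A measure $m$ on $X$ has full support if $m(x):=m(\{x\})>0$ for all $x\in X$; $\ell^2(X,m)=\{f:X\to\mathbb R\mid\|f\|_2^2=\sum_x|f(x)|^2m(x)<\infty\}$. $\mathcal E^{(N)}$ is the restriction of $\mathcal E$ to $\mathcal D\cap\ell^2(X,m)$, a closed (not necessarily densely defined) form on $\ell^2(X,m)$; $H_m^{(N)}$ is the associated nonnegative selfadjoint operator in the closure of $\mathcal D\cap\ell^2(X,m)$ in $\ell^2(X,m)$. In the situation of the claim its spectrum consists of eigenvalues which can be listed in increasing order, the lowest being $0$ with the constant functions as eigenfunctions. If $\mathcal D$ contains only constant functions, $\lambda_1$ is understood as $+\infty$; also $4/0=+\infty$. *)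

theory Defs
  imports "HOL-Probability.Probability"
begin

text \<open>The vertex set is the whole (automatically nonempty) type \<open>'a\<close> of class \<open>countable\<close>.\<close>

definition weighted_graph :: "('a::countable \<Rightarrow> 'a \<Rightarrow> real) \<Rightarrow> bool" where
  "weighted_graph b \<longleftrightarrow>
     (\<forall>x y. 0 \<le> b x y) \<and> (\<forall>x y. b x y = b y x) \<and> (\<forall>x. b x x = 0)"

definition paths :: "('a \<Rightarrow> 'a \<Rightarrow> real) \<Rightarrow> 'a \<Rightarrow> 'a \<Rightarrow> 'a list set" where
  "paths b x y = {p. p \<noteq> [] \<and> hd p = x \<and> last p = y \<and>
     (\<forall>j < length p - 1. 0 < b (p ! j) (p ! Suc j))}"

definition path_length :: "('a \<Rightarrow> 'a \<Rightarrow> real) \<Rightarrow> 'a list \<Rightarrow> real" where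
  "path_length b p = (\<Sum>j < length p - 1. 1 / b (p ! j) (p ! Suc j))"

definition connected_graph :: "('a \<Rightarrow> 'a \<Rightarrow> real) \<Rightarrow> bool" where
  "connected_graph b \<longleftrightarrow> (\<forall>x y. paths b x y \<noteq> {})"

definition path_dist :: "('a \<Rightarrow> 'a \<Rightarrow> real) \<Rightarrow> 'a \<Rightarrow> 'a \<Rightarrow> ereal" where
  "path_dist b x y = (INF p \<in> paths b x y. ereal (path_length b p))"

definition finite_energy :: "('a \<Rightarrow> 'a \<Rightarrow> real) \<Rightarrow> ('a \<Rightarrow> real) set" where
  "finite_energy b = {f. (\<lambda>(x, y). b x y * \<bar>f x - f y\<bar>\<^sup>2) summable_on UNIV}"

definition energy :: "('a \<Rightarrow> 'a \<Rightarrow> real) \<Rightarrow> ('a \<Rightarrow> real) \<Rightarrow> ('a \<Rightarrow> real) \<Rightarrow> real" where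
  "energy b f g = 1 / 2 * (\<Sum>\<^sub>\<infinity>(x, y). b x y * (f x - f y) * (g x - g y))"

definition variation :: "('a \<Rightarrow> real) \<Rightarrow> ereal" where
  "variation f = (SUP x. ereal (f x)) - (INF x. ereal (f x))"

definition resistance :: "('a \<Rightarrow> 'a \<Rightarrow> real) \<Rightarrow> 'a \<Rightarrow> 'a \<Rightarrow> ereal" where
  "resistance b x y =
     (SUP f \<in> {f \<in> finite_energy b. energy b f f \<le> 1}. ereal (\<bar>f x - f y\<bar>\<^sup>2))"

definition diam :: "('a \<Rightarrow> 'a \<Rightarrow> ereal) \<Rightarrow> ereal" where
  "diam \<delta> = (SUP x. SUP y. \<delta> x y)"

definition full_support_prob :: "'a measure \<Rightarrow> bool" where
  "full_support_prob m \<longleftrightarrow> prob_space m \<and> sets m = UNIV \<and> (\<forall>x. 0 < measure m {x})"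

definition ell2 :: "'a measure \<Rightarrow> ('a \<Rightarrow> real) set" where
  "ell2 m = {f. (\<lambda>x. \<bar>f x\<bar>\<^sup>2 * measure m {x}) summable_on UNIV}"

definition ell2_inner :: "'a measure \<Rightarrow> ('a \<Rightarrow> real) \<Rightarrow> ('a \<Rightarrow> real) \<Rightarrow> real" where
  "ell2_inner m f g = (\<Sum>\<^sub>\<infinity>x. f x * g x * measure m {x})"

definition ell2_norm :: "'a measure \<Rightarrow> ('a \<Rightarrow> real) \<Rightarrow> real" where
  "ell2_norm m f = sqrt (ell2_inner m f f)"

definition neumann_form_dom :: "('a \<Rightarrow> 'a \<Rightarrow> real) \<Rightarrow> 'a measure \<Rightarrow> ('a \<Rightarrow> real) set" where
  "neumann_form_dom b m = finite_energy b \<inter> ell2 m"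

definition neumann_space :: "('a \<Rightarrow> 'a \<Rightarrow> real) \<Rightarrow> 'a measure \<Rightarrow> ('a \<Rightarrow> real) set" where
  "neumann_space b m =
     {h \<in> ell2 m. \<forall>\<epsilon>>0. \<exists>g \<in> neumann_form_dom b m. ell2_norm m (\<lambda>x. h x - g x) < \<epsilon>}"

text \<open>The graph of the operator \<open>H\<close> associated with the Neumann form, as given by the
  representation theorem for closed forms: \<open>f\<close> lies in the domain of \<open>H\<close> and \<open>H f = h\<close>.
  The form domain need not be dense in the whole of \<open>\<ell>\<^sup>2\<close>, so \<open>h\<close> has to be
  taken in its closure, where it is uniquely determined by \<open>f\<close>.\<close>

definition neumann_operator ::
    "('a \<Rightarrow> 'a \<Rightarrow> real) \<Rightarrow> 'a measure \<Rightarrow> ('a \<Rightarrow> real) \<Rightarrow> ('a \<Rightarrow> real) \<Rightarrow> bool" where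
  "neumann_operator b m f h \<longleftrightarrow>
     f \<in> neumann_form_dom b m \<and> h \<in> neumann_space b m \<and>
     (\<forall>g \<in> neumann_form_dom b m. energy b f g = ell2_inner m h g)"

definition neumann_eigenfunction ::
    "('a \<Rightarrow> 'a \<Rightarrow> real) \<Rightarrow> 'a measure \<Rightarrow> real \<Rightarrow> ('a \<Rightarrow> real) \<Rightarrow> bool" where
  "neumann_eigenfunction b m \<mu> f \<longleftrightarrow>
     (\<exists>x. f x \<noteq> 0) \<and> neumann_operator b m f (\<lambda>x. \<mu> * f x)"

definition lin_indep2 :: "('a \<Rightarrow> real) \<Rightarrow> ('a \<Rightarrow> real) \<Rightarrow> bool" where
  "lin_indep2 f g \<longleftrightarrow>
     (\<forall>\<alpha> \<beta>. (\<forall>x. \<alpha> * f x + \<beta> * g x = 0) \<longrightarrow> \<alpha> = 0 \<and> \<beta> = 0)"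

text \<open>The second entry \<open>\<lambda>\<^sub>1\<close> of the increasing list \<open>\<lambda>\<^sub>0 \<le> \<lambda>\<^sub>1 \<le> \<dots>\<close> of eigenvalues, counted with
  multiplicity: the smallest eigenvalue \<open>\<mu>\<close> such that there are two linearly independent
  eigenfunctions, one for \<open>\<mu>\<close> and one for some eigenvalue \<open>\<le> \<mu>\<close>.
  Since \<open>LEAST\<close> is unspecified when there is no minimum, a bound on \<open>lambda1\<close> can only be
  established together with the existence of this eigenvalue.\<close>

definition lambda1 :: "('a \<Rightarrow> 'a \<Rightarrow> real) \<Rightarrow> 'a measure \<Rightarrow> ereal" where
  "lambda1 b m =
     (if \<forall>f \<in> finite_energy b. \<exists>c. \<forall>x. f x = c then \<infinity>
      else ereal (LEAST \<mu>. \<exists>\<nu> f g. \<nu> \<le> \<mu> \<and> neumann_eigenfunction b m \<nu> f \<and>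
                     neumann_eigenfunction b m \<mu> g \<and> lin_indep2 f g))"

end

theory Submission
  imports Defs "HOL-Complex_Analysis.Great_Picard"
begin

text \<open>
  A path may be shortened to one without repeated vertices, so Cauchy--Schwarz along it gives
  \<open>(f x - f y)\<^sup>2 \<le> d(x, y) \<E>(f)\<close>. Hence the energy controls the
  oscillation, which yields conditions (i)--(iii), and for \<open>f\<close> of mean zero with values in an
  interval of length \<open>s\<close> one has \<open>4 \<parallel>f\<parallel>\<^sup>2 \<le> s\<^sup>2\<close>, so the Rayleigh quotient is at least
  \<open>4 / diam\<close>. The eigenvalue \<open>\<lambda>\<^sub>1\<close> exists by the direct method: a minimizing sequence of
  the Rayleigh quotient on mean-zero functions is uniformly bounded, hence converges pointwise along
  a subsequence. Dominated convergence preserves the constraints, and by Fatou the energy is lower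
  semicontinuous.
\<close>

section \<open>Paths and removal of loops\<close>

lemma path_length_Cons_Cons:
  "path_length b (x # y # zs) = 1 / b x y + path_length b (y # zs)"
  unfolding path_length_def by (simp add: sum.lessThan_Suc_shift del: sum.lessThan_Suc)

text \<open>The recursive form of the edge condition splits along conses and appends, which suits
  inductions over paths better than the indexed one.\<close>

lemma paths_iff_successively:
  "p \<in> paths b x y \<longleftrightarrow> p \<noteq> [] \<and> hd p = x \<and> last p = y \<and> successively (\<lambda>u v. 0 < b u v) p"
proof -
  have "successively P p \<longleftrightarrow> (\<forall>j < length p - 1. P (p ! j) (p ! Suc j))" for P :: "'a \<Rightarrow> 'a \<Rightarrow> bool"
    by (induction P p rule: successively.induct) (auto simp: less_Suc_eq_0_disj)
  then show ?thesis
    by (auto simp: paths_def)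
qed

lemma path_length_nonneg:
  assumes "\<And>x y. 0 \<le> b x y"
  shows "0 \<le> path_length b p"
  unfolding path_length_def by (intro sum_nonneg) (simp add: assms)

lemma path_length_suffix_le:
  assumes "\<And>x y. 0 \<le> b x y"
  shows "path_length b (x # zs) \<le> path_length b (ys @ x # zs)"
proof (induction ys)
  case (Cons y ys)
  have "path_length b (ys @ x # zs) \<le> path_length b (y # ys @ x # zs)"
    by (cases "ys @ x # zs") (auto simp: path_length_Cons_Cons assms)
  with Cons show ?case by simp
qed simp

text \<open>Induction on the path: first the tail is made free of repetitions. If the head already
  occurs in the new tail, the loop is cut off by keeping only the suffix from that occurrence on;
  this drops nonnegative summands, so the length does not grow.\<close>

lemma exists_distinct_path:
  assumes nonneg: "\<And>x y. 0 \<le> b x y" and "p \<in> paths b x y"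
  shows "\<exists>q \<in> paths b x y. distinct q \<and> path_length b q \<le> path_length b p"
  using assms(2)
proof (induction p arbitrary: x)
  case (Cons a p)
  show ?case
  proof (cases "p = []")
    case True
    with Cons.prems show ?thesis by (intro bexI[of _ "[a]"]) auto
  next
    case False
    then obtain c p' where p: "p = c # p'" by (cases p) auto
    from Cons.prems p have "p \<in> paths b c y" "0 < b a c" and a: "a = x"
      by (auto simp: paths_iff_successively)
    with Cons.IH obtain q where q: "q \<in> paths b c y" "distinct q"
      "path_length b q \<le> path_length b p" by blast
    then obtain q' where q': "q = c # q'"
      by (cases q) (auto simp: paths_iff_successively)
    have len: "path_length b (a # q) \<le> path_length b (a # p)"
      using q(3) by (simp add: p q' path_length_Cons_Cons)
    show ?thesis
    proof (cases "a \<in> set q")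
      case True
      then obtain ys zs where yz: "q = ys @ a # zs" by (meson split_list)
      have "a # zs \<in> paths b x y"
        using q(1) a by (auto simp: yz paths_iff_successively successively_append_iff)
      moreover have "distinct (a # zs)"
        using q(2) yz by auto
      moreover have "path_length b (a # zs) \<le> path_length b (a # p)"
        using path_length_suffix_le[where b = b and ys = "a # ys", OF nonneg] len
        by (fastforce simp: yz intro: order_trans)
      ultimately show ?thesis by blast
    next
      case False
      have "a # q \<in> paths b x y"
        using q(1) a \<open>0 < b a c\<close> by (auto simp: q' paths_iff_successively)
      with False q(2) len show ?thesis by (intro bexI[of _ "a # q"]) auto
    qed
  qed
qed (simp add: paths_iff_successively)

section \<open>The energy form on functions of finite energy\<close>

lemma finite_energy_iff:
  "f \<in> finite_energy b \<longleftrightarrow> (\<lambda>(x, y). b x y * (f x - f y)\<^sup>2) summable_on UNIV"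
  by (simp add: finite_energy_def)

lemma energy_self:
  "energy b f f = 1 / 2 * (\<Sum>\<^sub>\<infinity>(x, y). b x y * (f x - f y)\<^sup>2)"
  by (simp add: energy_def power2_eq_square mult.assoc)

lemma energy_nonneg:
  assumes "\<And>x y. 0 \<le> b x y"
  shows "0 \<le> energy b f f"
  unfolding energy_self using assms by (auto intro!: infsum_nonneg)

lemma finite_energy_const: "(\<lambda>_. c) \<in> finite_energy b"
  by (simp add: finite_energy_iff case_prod_unfold)

text \<open>Since \<open>\<bar>u * v\<bar>\<close> is at most the sum of the squares of
  \<open>u\<close> and \<open>v\<close>, the mixed terms are dominated by those of the two energies.
  So the sum in \<open>energy b f g\<close> is genuine and not the default value 0 of a divergent
  one.\<close>

lemma finite_energy_gradient_product_summable:
  assumes nonneg: "\<And>x y. 0 \<le> b x y"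
    and "f \<in> finite_energy b" "g \<in> finite_energy b"
  shows "(\<lambda>(x, y). b x y * (f x - f y) * (g x - g y)) summable_on UNIV"
proof -
  have "(\<lambda>z. norm ((\<lambda>(x, y). b x y * (f x - f y) * (g x - g y)) z)) summable_on UNIV"
  proof (rule Infinite_Sum.abs_summable_on_comparison_test)
    have "(\<lambda>z. (\<lambda>(x, y). b x y * (f x - f y)\<^sup>2) z + (\<lambda>(x, y). b x y * (g x - g y)\<^sup>2) z) summable_on UNIV"
      using assms(2,3) unfolding finite_energy_iff by (rule summable_on_add)
    then show "(\<lambda>z. norm ((\<lambda>(x, y). b x y * (f x - f y)\<^sup>2 + b x y * (g x - g y)\<^sup>2) z)) summable_on UNIV"
      using nonneg by (simp add: case_prod_unfold)
  next
    fix z :: "'a \<times> 'a"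
    obtain x y where z: "z = (x, y)" by (cases z)
    have "\<bar>u * v\<bar> \<le> u\<^sup>2 + v\<^sup>2" for u v :: real
      using sum_squares_bound[of "\<bar>u\<bar>" "\<bar>v\<bar>"] abs_ge_zero[of "u * v"]
      unfolding abs_mult power2_abs by linarith
    then show "norm ((\<lambda>(x, y). b x y * (f x - f y) * (g x - g y)) z)
        \<le> norm ((\<lambda>(x, y). b x y * (f x - f y)\<^sup>2 + b x y * (g x - g y)\<^sup>2) z)"
      using mult_left_mono[OF _ nonneg[of x y], of "\<bar>(f x - f y) * (g x - g y)\<bar>"
        "(f x - f y)\<^sup>2 + (g x - g y)\<^sup>2"] nonneg[of x y]
      by (simp add: z abs_mult mult.assoc distrib_left)
  qed
  then show ?thesis by (rule abs_summable_summable)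
qed

text \<open>Expanding the square splits the sum into three summable families. The resulting
  quadratic polynomial in \<open>t\<close> is what the first variation of the Rayleigh quotient
  needs.\<close>

lemma
  assumes nonneg: "\<And>x y. 0 \<le> b x y"
    and f: "f \<in> finite_energy b" and g: "g \<in> finite_energy b"
  shows finite_energy_add_scaled: "(\<lambda>x. f x + t * g x) \<in> finite_energy b"
    and energy_add_scaled: "energy b (\<lambda>x. f x + t * g x) (\<lambda>x. f x + t * g x)
      = energy b f f + 2 * t * energy b f g + t\<^sup>2 * energy b g g"
proof -
  let ?F = "\<lambda>(x, y). b x y * (f x - f y)\<^sup>2"
  let ?G = "\<lambda>(x, y). b x y * (g x - g y)\<^sup>2"
  let ?M = "\<lambda>(x, y). b x y * (f x - f y) * (g x - g y)"
  have F: "?F summable_on UNIV" and G: "(\<lambda>z. t\<^sup>2 * ?G z) summable_on UNIV"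
    using f g unfolding finite_energy_iff by (auto intro: summable_on_cmult_right)
  have M: "(\<lambda>z. 2 * t * ?M z) summable_on UNIV"
    using finite_energy_gradient_product_summable[OF assms] by (rule summable_on_cmult_right)
  have FM: "(\<lambda>z. ?F z + 2 * t * ?M z) summable_on UNIV"
    using F M by (rule summable_on_add)
  have eq: "(\<lambda>(x, y). b x y * ((f x + t * g x) - (f y + t * g y))\<^sup>2)
      = (\<lambda>z. (?F z + 2 * t * ?M z) + t\<^sup>2 * ?G z)"
    by (auto simp: fun_eq_iff power2_eq_square algebra_simps)
  show "(\<lambda>x. f x + t * g x) \<in> finite_energy b"
    unfolding finite_energy_iff eq using FM G by (rule summable_on_add)
  show "energy b (\<lambda>x. f x + t * g x) (\<lambda>x. f x + t * g x)
      = energy b f f + 2 * t * energy b f g + t\<^sup>2 * energy b g g"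
    unfolding energy_self eq energy_def[of b f g] infsum_add[OF FM G] infsum_add[OF F M]
      infsum_cmult_right'
    by (simp add: algebra_simps)
qed

lemma energy_const_right: "energy b f (\<lambda>_. c) = 0"
  by (simp add: energy_def case_prod_unfold)

lemma energy_const_left: "energy b (\<lambda>_. c) f = 0"
  by (simp add: energy_def case_prod_unfold)

lemma
  shows finite_energy_scale: "f \<in> finite_energy b \<Longrightarrow> (\<lambda>x. c * f x) \<in> finite_energy b"
    and energy_scale: "energy b (\<lambda>x. c * f x) (\<lambda>x. c * f x) = c\<^sup>2 * energy b f f"
proof -
  have eq: "(\<lambda>(x, y). b x y * (c * f x - c * f y)\<^sup>2)
      = (\<lambda>z. c\<^sup>2 * (\<lambda>(x, y). b x y * (f x - f y)\<^sup>2) z)"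
    by (auto simp: fun_eq_iff power2_eq_square algebra_simps)
  show "f \<in> finite_energy b \<Longrightarrow> (\<lambda>x. c * f x) \<in> finite_energy b"
    unfolding finite_energy_iff eq by (rule summable_on_cmult_right)
  show "energy b (\<lambda>x. c * f x) (\<lambda>x. c * f x) = c\<^sup>2 * energy b f f"
    unfolding energy_self eq by (simp only: infsum_cmult_right' mult.left_commute)
qed

lemma energy_shift: "energy b f (\<lambda>x. g x + c) = energy b f g"
  by (simp add: energy_def)

lemma finite_energy_shift:
  assumes "f \<in> finite_energy b"
  shows "(\<lambda>x. f x + c) \<in> finite_energy b"
  using assms by (simp add: finite_energy_def)

text \<open>Fatou by hand: over a finite set of pairs the limit passes through the sum, which stays
  below \<open>2 * E\<close>; the supremum over finite sets then gives both claims. The 2 undoes the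
  factor 1/2 in \<open>energy\<close>.\<close>

lemma energy_lower_semicontinuous:
  fixes f :: "nat \<Rightarrow> 'a \<Rightarrow> real"
  assumes nonneg: "\<And>x y. 0 \<le> b x y"
    and fin: "\<And>n. f n \<in> finite_energy b"
    and lim: "\<And>x. (\<lambda>n. f n x) \<longlonglongrightarrow> g x"
    and conv: "(\<lambda>n. energy b (f n) (f n)) \<longlonglongrightarrow> E"
  shows "g \<in> finite_energy b" and "energy b g g \<le> E"
proof -
  have bound: "(\<Sum>(x, y)\<in>F. b x y * (g x - g y)\<^sup>2) \<le> 2 * E" if "finite F" for F
  proof (rule LIMSEQ_le)
    show "(\<lambda>n. \<Sum>(x, y)\<in>F. b x y * (f n x - f n y)\<^sup>2) \<longlonglongrightarrow> (\<Sum>(x, y)\<in>F. b x y * (g x - g y)\<^sup>2)"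
      unfolding case_prod_unfold by (intro tendsto_intros lim)
    show "(\<lambda>n. 2 * energy b (f n) (f n)) \<longlonglongrightarrow> 2 * E"
      by (intro tendsto_intros conv)
    have "(\<Sum>(x, y)\<in>F. b x y * (f n x - f n y)\<^sup>2) \<le> 2 * energy b (f n) (f n)" for n
      unfolding energy_self
      using finite_sum_le_infsum[OF fin[of n, unfolded finite_energy_iff] that] nonneg by auto
    then show "\<exists>N. \<forall>n\<ge>N. (\<Sum>(x, y)\<in>F. b x y * (f n x - f n y)\<^sup>2) \<le> 2 * energy b (f n) (f n)"
      by blast
  qed
  show fin_g: "g \<in> finite_energy b"
    unfolding finite_energy_iff
    using nonneg bound by (intro nonneg_bdd_above_summable_on) (auto intro!: bdd_aboveI2)
  have "(\<Sum>\<^sub>\<infinity>(x, y). b x y * (g x - g y)\<^sup>2) \<le> 2 * E"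
    using fin_g[unfolded finite_energy_iff] bound by (rule infsum_le_finite_sums)
  then show "energy b g g \<le> E"
    by (simp add: energy_self)
qed

section \<open>Increments along paths bounded by the energy\<close>

lemma sum_edges_le_energy:
  assumes b: "weighted_graph b" and f: "f \<in> finite_energy b" and p: "distinct p"
  shows "(\<Sum>j < length p - 1. b (p ! j) (p ! Suc j) * (f (p ! j) - f (p ! Suc j))\<^sup>2) \<le> energy b f f"
proof -
  let ?I = "{..<length p - 1}"
  let ?e = "\<lambda>j. (p ! j, p ! Suc j)" and ?e' = "\<lambda>j. (p ! Suc j, p ! j)"
  let ?h = "\<lambda>(x, y). b x y * (f x - f y)\<^sup>2"
  have inj: "inj_on ?e ?I" "inj_on ?e' ?I"
    using p by (auto intro!: inj_onI simp: nth_eq_iff_index_eq)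
  \<comment> \<open>Equality of a forward edge \<open>j\<close> and a reversed edge \<open>i\<close>
    would force \<open>j = Suc i\<close> and \<open>Suc j = i\<close>.\<close>
  have disj: "?e ` ?I \<inter> ?e' ` ?I = {}"
    using p by (auto simp: nth_eq_iff_index_eq)
  \<comment> \<open>The double sum in the energy sees every edge in both orientations, which
    compensates its factor 1/2. Without repeated vertices, the forward and reversed edges are all
    different pairs.\<close>
  have "2 * (\<Sum>j\<in>?I. ?h (?e j)) = (\<Sum>j\<in>?I. ?h (?e j)) + (\<Sum>j\<in>?I. ?h (?e' j))"
    using b by (simp add: weighted_graph_def power2_commute)
  also have "\<dots> = sum ?h (?e ` ?I) + sum ?h (?e' ` ?I)"
    by (simp only: sum.reindex[OF inj(1)] sum.reindex[OF inj(2)] o_def)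
  also have "\<dots> = sum ?h (?e ` ?I \<union> ?e' ` ?I)"
    using disj by (simp add: sum.union_disjoint)
  also have "\<dots> \<le> infsum ?h UNIV"
    using f b unfolding finite_energy_iff weighted_graph_def
    by (intro finite_sum_le_infsum) auto
  finally show ?thesis
    by (simp add: energy_self)
qed

lemma increment_sq_le_path_length_mult_energy:
  assumes b: "weighted_graph b" and f: "f \<in> finite_energy b" and p: "p \<in> paths b x y"
  shows "(f x - f y)\<^sup>2 \<le> path_length b p * energy b f f"
proof -
  have nonneg: "\<And>x y. 0 \<le> b x y"
    using b by (simp add: weighted_graph_def)
  obtain q where q: "q \<in> paths b x y" "distinct q" "path_length b q \<le> path_length b p"
    using exists_distinct_path[OF nonneg p] by blast
  let ?I = "{..<length q - 1}"
  have ne: "q \<noteq> []" and hd: "x = q ! 0" and last: "y = q ! (length q - 1)"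
    and pos: "\<And>j. j \<in> ?I \<Longrightarrow> 0 < b (q ! j) (q ! Suc j)"
    using q(1) by (auto simp: paths_def hd_conv_nth last_conv_nth)
  have "f x - f y = (\<Sum>j\<in>?I. f (q ! j) - f (q ! Suc j))"
    unfolding hd last by (rule sum_lessThan_telescope'[symmetric])
  \<comment> \<open>Each increment is written as root of resistance times root of conductance times
    increment, so that Cauchy-Schwarz yields the path length and the energy along the path as its
    two factors.\<close>
  also have "\<dots> = (\<Sum>j\<in>?I. sqrt (1 / b (q ! j) (q ! Suc j)) *
      (sqrt (b (q ! j) (q ! Suc j)) * (f (q ! j) - f (q ! Suc j))))"
    using pos by (intro sum.cong) (fastforce simp: real_sqrt_divide)+
  finally have "(f x - f y)\<^sup>2 \<le> (\<Sum>j\<in>?I. (sqrt (1 / b (q ! j) (q ! Suc j)))\<^sup>2) *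
      (\<Sum>j\<in>?I. (sqrt (b (q ! j) (q ! Suc j)) * (f (q ! j) - f (q ! Suc j)))\<^sup>2)"
    by (simp only: Cauchy_Schwarz_ineq_sum)
  also have "\<dots> = path_length b q *
      (\<Sum>j\<in>?I. b (q ! j) (q ! Suc j) * (f (q ! j) - f (q ! Suc j))\<^sup>2)"
    using nonneg by (simp add: path_length_def power_mult_distrib)
  also have "\<dots> \<le> path_length b p * energy b f f"
    using sum_edges_le_energy[OF b f q(2)] q(3) path_length_nonneg[OF nonneg]
    by (intro mult_mono sum_nonneg) (auto simp: nonneg)
  finally show ?thesis .
qed

lemma path_dist_nonneg:
  assumes "\<And>x y. 0 \<le> b x y"
  shows "0 \<le> path_dist b x y"
  unfolding path_dist_def by (intro INF_greatest) (simp add: path_length_nonneg[OF assms])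

lemma increment_sq_le_diam_mult_energy:
  assumes b: "weighted_graph b" and f: "f \<in> finite_energy b"
    and diam: "diam (path_dist b) = ereal D"
  shows "(f x - f y)\<^sup>2 \<le> D * energy b f f"
proof -
  have E: "0 \<le> energy b f f"
    using b by (intro energy_nonneg) (simp add: weighted_graph_def)
  have "path_dist b x y \<le> ereal D"
    unfolding diam[symmetric] Defs.diam_def by (meson SUP_upper UNIV_I order_trans)
  \<comment> \<open>The infimum over paths need not be attained, so some slack \<open>e\<close> is
    granted and sent to 0 afterwards.\<close>
  have "(f x - f y)\<^sup>2 \<le> (D + e) * energy b f f" if "e > 0" for e
  proof -
    have "path_dist b x y < ereal (D + e)"
      using \<open>path_dist b x y \<le> ereal D\<close> that by (simp add: le_less_trans)
    then obtain p where "p \<in> paths b x y" "path_length b p < D + e"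
      unfolding path_dist_def by (auto simp: INF_less_iff)
    then show ?thesis
      using increment_sq_le_path_length_mult_energy[OF b f] E
      by (meson less_imp_le mult_right_mono order_trans)
  qed
  then have "\<forall>e>0. (f x - f y)\<^sup>2 \<le> D * energy b f f + e * energy b f f"
    by (simp add: distrib_right)
  moreover have "((\<lambda>e. D * energy b f f + e * energy b f f) \<longlongrightarrow> D * energy b f f + 0 * energy b f f) (at_right 0)"
    by (intro tendsto_intros)
  ultimately show ?thesis
    by (intro tendsto_lowerbound[where F = "at_right 0"])
      (auto simp: eventually_at_filter intro: always_eventually)
qed

section \<open>Sums and integrals for a probability measure of full support\<close>

lemma measurable_full_support_prob:
  fixes f :: "'a \<Rightarrow> real"
  assumes "full_support_prob m"
  shows "f \<in> borel_measurable m"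
proof -
  have "sets m = UNIV" using assms by (simp add: full_support_prob_def)
  then show ?thesis by (simp add: measurable_def)
qed

lemma integrable_full_support_prob:
  fixes f :: "'a \<Rightarrow> real"
  assumes m: "full_support_prob m" and "bounded (range f)"
  shows "integrable m f"
proof -
  interpret prob_space m using m by (simp add: full_support_prob_def)
  obtain B where "\<And>x. norm (f x) \<le> B"
    using assms(2) by (auto simp: bounded_iff)
  then show ?thesis
    using measurable_full_support_prob[OF m] by (intro integrable_const_bound[of _ B]) auto
qed

text \<open>The bridge from the infinite sums defining \<open>ell2\<close> and
  \<open>ell2_inner\<close> to integrals, for which monotonicity and dominated convergence are at
  hand.\<close>

lemma
  fixes f :: "'a::countable \<Rightarrow> real"
  assumes m: "full_support_prob m" and f: "bounded (range f)"
  shows bounded_times_measure_summable: "(\<lambda>x. f x * measure m {x}) summable_on UNIV"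
    and infsum_times_measure: "(\<Sum>\<^sub>\<infinity>x. f x * measure m {x}) = (\<integral>x. f x \<partial>m)"
proof -
  interpret prob_space m using m by (simp add: full_support_prob_def)
  \<comment> \<open>All sets are measurable and every point has positive mass, so \<open>m\<close>
    is a probability mass function and expectations under it are sums.\<close>
  define p where "p = Abs_pmf m"
  have p: "measure_pmf p = m"
    unfolding p_def
    using m by (intro Abs_pmf_inverse) (auto simp: full_support_prob_def less_imp_neq[symmetric])
  have pmf: "pmf p x = measure m {x}" for x
    by (simp flip: p add: measure_pmf_single)
  obtain B where B: "\<And>x. norm (f x) \<le> B"
    using f by (auto simp: bounded_iff)
  have "(\<lambda>x. norm (pmf p x)) summable_on UNIV"
    using pmf_abs_summable[of p UNIV] by (simp only: abs_summable_equivalent)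
  then have "(\<lambda>x. B * pmf p x) summable_on UNIV"
    by (intro summable_on_cmult_right) simp
  then have "(\<lambda>x. norm (pmf p x * f x)) summable_on UNIV"
    by (rule summable_on_comparison_test)
      (use B in \<open>auto simp: abs_mult mult.commute[of B] intro!: mult_left_mono\<close>)
  then have abs: "Infinite_Sum.abs_summable_on (\<lambda>x. pmf p x * f x) UNIV" .
  show "(\<lambda>x. f x * measure m {x}) summable_on UNIV"
    using abs_summable_summable[OF abs] by (simp add: pmf mult.commute)
  have "(\<integral>x. f x \<partial>m) = (\<Sum>\<^sub>\<infinity>x. pmf p x * f x)"
    unfolding p[symmetric] pmf_expectation_eq_infsetsum
    using abs by (intro infsetsum_infsum) (simp only: abs_summable_equivalent)
  then show "(\<Sum>\<^sub>\<infinity>x. f x * measure m {x}) = (\<integral>x. f x \<partial>m)"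
    by (simp add: pmf mult.commute)
qed

lemma bounded_range_mult:
  fixes f g :: "'a \<Rightarrow> real"
  assumes "bounded (range f)" "bounded (range g)"
  shows "bounded (range (\<lambda>x. f x * g x))"
proof -
  obtain B C where "\<And>x. \<bar>f x\<bar> \<le> B" "\<And>x. \<bar>g x\<bar> \<le> C"
    using assms by (auto simp: bounded_iff)
  then have "\<bar>f x * g x\<bar> \<le> B * C" for x
    unfolding abs_mult by (meson abs_ge_zero mult_mono order_trans)
  then show ?thesis by (auto simp: bounded_iff)
qed

lemma bounded_in_ell2:
  fixes f :: "'a::countable \<Rightarrow> real"
  assumes "full_support_prob m" "bounded (range f)"
  shows "f \<in> ell2 m"
  using bounded_times_measure_summable[OF assms(1) bounded_range_mult[OF assms(2,2)]]
  by (simp add: ell2_def power2_eq_square)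

lemma ell2_inner_eq_integral:
  fixes f g :: "'a::countable \<Rightarrow> real"
  assumes "full_support_prob m" "bounded (range f)" "bounded (range g)"
  shows "ell2_inner m f g = (\<integral>x. f x * g x \<partial>m)"
  unfolding ell2_inner_def using assms by (intro infsum_times_measure bounded_range_mult)

text \<open>A single point with nonzero value already contributes a positive term, by full
  support.\<close>

lemma integral_square_pos:
  fixes f :: "'a::countable \<Rightarrow> real"
  assumes m: "full_support_prob m" and f: "bounded (range f)" and x: "f x \<noteq> 0"
  shows "0 < (\<integral>x. f x * f x \<partial>m)"
proof -
  have "0 < f x * f x * measure m {x}"
    using m x by (auto simp: full_support_prob_def zero_less_mult_iff)
  also have "\<dots> \<le> (\<Sum>\<^sub>\<infinity>x. f x * f x * measure m {x})"
    using finite_sum_le_infsum[OF bounded_times_measure_summable[OF m bounded_range_mult[OF f f]], of "{x}"]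
    by simp
  finally show ?thesis
    by (simp add: infsum_times_measure m bounded_range_mult f)
qed

section \<open>Oscillation, variance and vanishing first variation\<close>

lemma bounded_oscillation_interval:
  fixes f :: "'a \<Rightarrow> real"
  assumes "\<And>x y. \<bar>f x - f y\<bar> \<le> s"
  shows "\<exists>a. \<forall>x. a \<le> f x \<and> f x \<le> a + s"
proof (intro exI allI conjI)
  have lower: "f x - s \<le> f y" for x y
    using assms[of x y] by simp
  then have "bdd_below (range f)"
    by (intro bdd_belowI2[of _ "f undefined - s"])
  then show "(INF x. f x) \<le> f x" for x
    by (rule cINF_lower) simp
  have "f x - s \<le> (INF x. f x)" for x
    using lower by (intro cINF_greatest) auto
  then show "f x \<le> (INF x. f x) + s" for x
    by (simp add: algebra_simps)
qed

text \<open>For small \<open>t\<close> of sign opposite to \<open>a\<close> the linear term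
  dominates. Dividing \<open>a\<close> by \<open>\<bar>c\<bar> + 1\<close> makes \<open>t\<close>
  small enough, whatever the sign of \<open>c\<close>.\<close>

lemma linear_coeff_eq_0:
  fixes a c :: real
  assumes "\<And>t. 0 \<le> 2 * t * a + t\<^sup>2 * c"
  shows "a = 0"
proof (rule ccontr)
  assume "a \<noteq> 0"
  define s where "s = a / (\<bar>c\<bar> + 1)"
  have a: "a = s * (\<bar>c\<bar> + 1)"
    by (simp add: s_def)
  have "2 * (- s) * a + (- s)\<^sup>2 * c = s\<^sup>2 * (c - 2 * (\<bar>c\<bar> + 1))"
    by (simp add: a power2_eq_square algebra_simps)
  moreover have "s\<^sup>2 * (c - 2 * (\<bar>c\<bar> + 1)) < 0"
    using \<open>a \<noteq> 0\<close> a by (intro mult_pos_neg) auto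
  ultimately show False
    using assms[of "- s"] by linarith
qed

text \<open>The second bound is Popoviciu's inequality for the variance; it is the source of the
  constant 4 in the eigenvalue estimate. The first holds because the interval containing all values
  also contains the mean 0.\<close>

lemma (in prob_space) mean_zero_bounds:
  fixes f :: "'a \<Rightarrow> real"
  assumes int: "integrable M f" "integrable M (\<lambda>x. f x * f x)" and mean: "(\<integral>x. f x \<partial>M) = 0"
    and osc: "\<And>x y. \<bar>f x - f y\<bar> \<le> s"
  shows "\<bar>f x\<bar> \<le> s" and "4 * (\<integral>x. f x * f x \<partial>M) \<le> s\<^sup>2"
proof -
  obtain a where a: "\<And>x. a \<le> f x" "\<And>x. f x \<le> a + s"
    using bounded_oscillation_interval[of f s, OF osc] by blast
  have "a \<le> (\<integral>x. f x \<partial>M)" "(\<integral>x. f x \<partial>M) \<le> a + s"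
    using a int(1) by (auto intro!: integral_ge_const integral_le_const)
  then have "a \<le> 0" "0 \<le> a + s"
    by (simp_all add: mean)
  then show "\<bar>f x\<bar> \<le> s"
    using a[of x] by linarith
  \<comment> \<open>This is the expanded form of \<open>(f x - a) * (a + s - f x)\<close> being
    nonnegative. Integrating it bounds the variance by \<open>- a * (a + s)\<close>, and
    \<open>s\<^sup>2 + 4 * a * (a + s)\<close> is the square of \<open>2 * a + s\<close>.\<close>
  have "f x * f x \<le> (2 * a + s) * f x - a * (a + s)" for x
    using mult_nonneg_nonneg[of "f x - a" "a + s - f x"] a[of x] by (simp add: algebra_simps)
  then have "(\<integral>x. f x * f x \<partial>M) \<le> (\<integral>x. (2 * a + s) * f x - a * (a + s) \<partial>M)"
    using int by (intro integral_mono) auto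
  also have "\<dots> = - a * (a + s)"
    using int(1) by (simp add: mean prob_space)
  finally show "4 * (\<integral>x. f x * f x \<partial>M) \<le> s\<^sup>2"
    using zero_le_power2[of "2 * a + s"] by (simp add: power2_eq_square algebra_simps)
qed

text \<open>Isolates the outcome of the path argument: within this locale paths no longer occur.
  \<open>D\<close> will be the diameter with respect to \<open>path_dist\<close>.\<close>

locale energy_controls_oscillation =
  fixes b :: "'a::countable \<Rightarrow> 'a \<Rightarrow> real" and D :: real
  assumes weight_nonneg: "0 \<le> b x y"
    and D_nonneg: "0 \<le> D"
    and oscillation: "f \<in> finite_energy b \<Longrightarrow> (f x - f y)\<^sup>2 \<le> D * energy b f f"
begin

lemma oscillation_sqrt:
  assumes "f \<in> finite_energy b"
  shows "\<bar>f x - f y\<bar> \<le> sqrt (D * energy b f f)"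
  using real_sqrt_le_mono[OF oscillation[OF assms, of x y]] by simp

lemma finite_energy_bounded:
  assumes "f \<in> finite_energy b"
  shows "bounded (range f)"
proof -
  obtain a where "\<And>x. a \<le> f x \<and> f x \<le> a + sqrt (D * energy b f f)"
    using bounded_oscillation_interval[of f, OF oscillation_sqrt[OF assms]] by blast
  then have "range f \<subseteq> {a .. a + sqrt (D * energy b f f)}" by auto
  then show ?thesis by (meson bounded_closed_interval bounded_subset)
qed

end

section \<open>The variational problem on mean-zero functions\<close>

locale energy_controls_oscillation_prob = energy_controls_oscillation b D
  for b :: "'a::countable \<Rightarrow> 'a \<Rightarrow> real" and D +
  fixes m :: "'a measure"
  assumes full_support: "full_support_prob m"
begin

sublocale prob_space m
  using full_support by (simp add: full_support_prob_def)

lemma integrable_finite_energy: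
  assumes "f \<in> finite_energy b"
  shows "integrable m f"
  using assms by (intro integrable_full_support_prob full_support finite_energy_bounded)

lemma integrable_finite_energy_mult:
  assumes "f \<in> finite_energy b" "g \<in> finite_energy b"
  shows "integrable m (\<lambda>x. f x * g x)"
  using assms by (intro integrable_full_support_prob full_support bounded_range_mult finite_energy_bounded)

lemma
  assumes f: "f \<in> finite_energy b" and mean: "(\<integral>x. f x \<partial>m) = 0"
  shows mean_zero_abs_le: "\<bar>f x\<bar> \<le> sqrt (D * energy b f f)"
    and poincare: "4 * (\<integral>x. f x * f x \<partial>m) \<le> D * energy b f f"
proof -
  note bounds = mean_zero_bounds[OF integrable_finite_energy[OF f] integrable_finite_energy_mult[OF f f]
    mean oscillation_sqrt[OF f]]
  show "\<bar>f x\<bar> \<le> sqrt (D * energy b f f)" by (rule bounds(1))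
  show "4 * (\<integral>x. f x * f x \<partial>m) \<le> D * energy b f f"
    using bounds(2) D_nonneg energy_nonneg[where b = b, OF weight_nonneg] by simp
qed

text \<open>Mean zero is orthogonality to the constants, the eigenfunctions for 0. The minimum of
  the energy over this set will turn out to be \<lambda>_1.\<close>

definition unit_mean_zero :: "('a \<Rightarrow> real) set" where
  "unit_mean_zero = {f \<in> finite_energy b. (\<integral>x. f x \<partial>m) = 0 \<and> (\<integral>x. f x * f x \<partial>m) = 1}"

lemma normalize_in_unit_mean_zero:
  assumes f: "f \<in> finite_energy b" and mean: "(\<integral>x. f x \<partial>m) = 0" and pos: "0 < (\<integral>x. f x * f x \<partial>m)"
  shows "(\<lambda>x. 1 / sqrt (\<integral>x. f x * f x \<partial>m) * f x) \<in> unit_mean_zero"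
proof -
  let ?c = "1 / sqrt (\<integral>x. f x * f x \<partial>m)"
  have "(\<integral>x. ?c * f x * (?c * f x) \<partial>m) = (\<integral>x. ?c\<^sup>2 * (f x * f x) \<partial>m)"
    by (simp add: power2_eq_square)
  also have "\<dots> = ?c\<^sup>2 * (\<integral>x. f x * f x \<partial>m)"
    by (rule integral_mult_right_zero)
  also have "\<dots> = 1"
    using pos by (simp add: power_divide)
  finally show ?thesis
    unfolding unit_mean_zero_def
    using finite_energy_scale[OF f, of ?c] integral_mult_right_zero[of m ?c f] mean by simp
qed

lemma unit_mean_zero_nonempty:
  assumes f: "f \<in> finite_energy b" and "f x \<noteq> f y"
  shows "unit_mean_zero \<noteq> {}"
proof -
  define g where "g = (\<lambda>z. f z + - (\<integral>z. f z \<partial>m))"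
  have g: "g \<in> finite_energy b"
    unfolding g_def by (rule finite_energy_shift[OF f])
  have "g x \<noteq> 0 \<or> g y \<noteq> 0"
    using assms(2) by (auto simp: g_def)
  then have "0 < (\<integral>x. g x * g x \<partial>m)"
    using integral_square_pos[OF full_support finite_energy_bounded[OF g]] by blast
  moreover have "(\<integral>x. g x \<partial>m) = 0"
    using integrable_finite_energy[OF f] by (simp add: g_def prob_space)
  ultimately show ?thesis
    using normalize_in_unit_mean_zero[OF g] by blast
qed

text \<open>Compactness comes from \<open>mean_zero_abs_le\<close>: functions of mean zero and
  bounded energy are uniformly bounded.\<close>

lemma rayleigh_minimizer_exists:
  assumes "unit_mean_zero \<noteq> {}"
  obtains f where "f \<in> unit_mean_zero" "\<And>g. g \<in> unit_mean_zero \<Longrightarrow> energy b f f \<le> energy b g g"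
proof -
  define l where "l = (INF g\<in>unit_mean_zero. energy b g g)"
  have bdd: "bdd_below ((\<lambda>g. energy b g g) ` unit_mean_zero)"
    by (rule bdd_belowI2) (rule energy_nonneg[OF weight_nonneg])
  have lower: "l \<le> energy b g g" if "g \<in> unit_mean_zero" for g
    unfolding l_def using bdd that by (rule cINF_lower)
  have "\<exists>g\<in>unit_mean_zero. energy b g g < l + 1 / real (Suc n)" for n
  proof (rule ccontr)
    assume "\<not> ?thesis"
    then have "l + 1 / real (Suc n) \<le> l"
      unfolding l_def by (intro cINF_greatest assms) (auto simp: not_less l_def)
    then show False by simp
  qed
  then obtain F where F: "\<And>n. F n \<in> unit_mean_zero"
    and upper: "\<And>n. energy b (F n) (F n) < l + 1 / real (Suc n)"
    by metis
  have fin: "F n \<in> finite_energy b" and mean: "(\<integral>x. F n x \<partial>m) = 0"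
    and unit: "(\<integral>x. F n x * F n x \<partial>m) = 1" for n
    using F[of n] by (auto simp: unit_mean_zero_def)
  \<comment> \<open>Every member of the minimizing sequence has energy at most \<open>l + 1\<close>,
    as the excess is below \<open>1 / real (Suc n)\<close>.\<close>
  define B where "B = sqrt (D * (l + 1))"
  have B: "\<bar>F n x\<bar> \<le> B" for n x
  proof -
    have "1 / real (Suc n) \<le> 1" by simp
    then have "energy b (F n) (F n) \<le> l + 1" using upper[of n] by linarith
    then have "sqrt (D * energy b (F n) (F n)) \<le> B"
      unfolding B_def using D_nonneg by (intro real_sqrt_le_mono mult_left_mono)
    with mean_zero_abs_le[OF fin mean, of n x] show ?thesis by linarith
  qed
  \<comment> \<open>A diagonal argument over the countable vertex set.\<close>
  obtain k where k: "strict_mono (k :: nat \<Rightarrow> nat)" "\<And>x. \<exists>z. (\<lambda>n. F (k n) x) \<longlonglongrightarrow> z"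
    using function_convergent_subsequence[of UNIV F B] B by auto
  then obtain f where f: "\<And>x. (\<lambda>n. F (k n) x) \<longlonglongrightarrow> f x"
    by metis
  have energies: "(\<lambda>n. energy b (F n) (F n)) \<longlonglongrightarrow> l"
  proof (rule tendsto_sandwich[OF _ _ tendsto_const])
    show "(\<lambda>n. l + 1 / real (Suc n)) \<longlonglongrightarrow> l"
      by real_asymp
  qed (use lower[OF F] upper in \<open>auto intro!: always_eventually less_imp_le simp del: of_nat_Suc\<close>)
  note lsc = energy_lower_semicontinuous[OF weight_nonneg fin f
    LIMSEQ_subseq_LIMSEQ[OF energies k(1), unfolded o_def]]
  note [measurable] = measurable_full_support_prob[OF full_support]
  \<comment> \<open>Constants are integrable majorants for a probability measure, so mean zero and,
    with \<open>B * B\<close>, unit norm survive in the limit.\<close>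
  have "(\<lambda>n. \<integral>x. F (k n) x \<partial>m) \<longlonglongrightarrow> (\<integral>x. f x \<partial>m)"
    using B f by (intro integral_dominated_convergence[where w = "\<lambda>_. B"]) auto
  then have "(\<integral>x. f x \<partial>m) = 0"
    by (simp add: mean LIMSEQ_const_iff)
  moreover have "(\<lambda>n. \<integral>x. F (k n) x * F (k n) x \<partial>m) \<longlonglongrightarrow> (\<integral>x. f x * f x \<partial>m)"
  proof (intro integral_dominated_convergence[where w = "\<lambda>_. B * B"] AE_I2)
    show "norm (F (k n) x * F (k n) x) \<le> B * B" for n x
      using mult_mono[OF B[of "k n" x] B[of "k n" x]] B[of "k n" x] by (simp add: abs_mult)
    show "(\<lambda>n. F (k n) x * F (k n) x) \<longlonglongrightarrow> f x * f x" for x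
      by (intro tendsto_mult f)
  qed auto
  then have "(\<integral>x. f x * f x \<partial>m) = 1"
    by (simp add: unit LIMSEQ_const_iff)
  ultimately have "f \<in> unit_mean_zero"
    using lsc(1) by (simp add: unit_mean_zero_def)
  moreover have "energy b f f \<le> energy b g g" if "g \<in> unit_mean_zero" for g
    using lsc(2) lower[OF that] by linarith
  ultimately show ?thesis using that by blast
qed

text \<open>Both sides scale quadratically, so normalizing \<open>g\<close> reduces to the unit
  sphere; if the norm vanishes, the left side is 0.\<close>

lemma rayleigh_bound:
  assumes min: "\<And>g. g \<in> unit_mean_zero \<Longrightarrow> l \<le> energy b g g"
    and g: "g \<in> finite_energy b" and mean: "(\<integral>x. g x \<partial>m) = 0"
  shows "l * (\<integral>x. g x * g x \<partial>m) \<le> energy b g g"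
proof (cases "(\<integral>x. g x * g x \<partial>m) > 0")
  case True
  have "l \<le> (1 / sqrt (\<integral>x. g x * g x \<partial>m))\<^sup>2 * energy b g g"
    using min[OF normalize_in_unit_mean_zero[OF g mean True]] unfolding energy_scale .
  with True show ?thesis
    by (simp add: power_divide field_simps)
next
  case False
  moreover have "0 \<le> (\<integral>x. g x * g x \<partial>m)" by (intro integral_nonneg_AE) auto
  ultimately show ?thesis
    using energy_nonneg[OF weight_nonneg] by (simp add: order_antisym)
qed

text \<open>Euler-Lagrange equation: energy minus \<open>energy b f f\<close> times the squared norm
  is nonnegative on mean-zero functions and vanishes at \<open>f\<close>, so its first variation
  there is zero.\<close>

lemma rayleigh_minimizer_weak_eigenfunction:
  assumes f: "f \<in> unit_mean_zero"
    and min: "\<And>g. g \<in> unit_mean_zero \<Longrightarrow> energy b f f \<le> energy b g g"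
    and g: "g \<in> finite_energy b"
  shows "energy b f g = energy b f f * (\<integral>x. f x * g x \<partial>m)"
proof -
  \<comment> \<open>Variations must keep the mean zero, hence \<open>g\<close> is centred. This
    changes neither side of the claim: the energy ignores constants, and \<open>f\<close> is
    orthogonal to them.\<close>
  define h where "h = (\<lambda>x. g x + - (\<integral>x. g x \<partial>m))"
  let ?l = "energy b f f"
  have fin: "f \<in> finite_energy b" "h \<in> finite_energy b"
    using f finite_energy_shift[OF g] unfolding unit_mean_zero_def h_def by blast+
  have mean_f: "(\<integral>x. f x \<partial>m) = 0" and unit: "(\<integral>x. f x * f x \<partial>m) = 1"
    using f by (auto simp: unit_mean_zero_def)
  have mean_h: "(\<integral>x. h x \<partial>m) = 0"
    using integrable_finite_energy[OF g] by (simp add: h_def prob_space)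
  have "energy b f h - ?l * (\<integral>x. f x * h x \<partial>m) = 0"
  proof (rule linear_coeff_eq_0)
    fix t :: real
    have "(\<integral>x. (f x + t * h x) * (f x + t * h x) \<partial>m)
        = (\<integral>x. f x * f x + 2 * t * (f x * h x) + t\<^sup>2 * (h x * h x) \<partial>m)"
      by (simp add: power2_eq_square algebra_simps)
    also have "\<dots> = 1 + 2 * t * (\<integral>x. f x * h x \<partial>m) + t\<^sup>2 * (\<integral>x. h x * h x \<partial>m)"
      using fin by (simp add: integrable_finite_energy_mult unit)
    finally have norm: "(\<integral>x. (f x + t * h x) * (f x + t * h x) \<partial>m)
      = 1 + 2 * t * (\<integral>x. f x * h x \<partial>m) + t\<^sup>2 * (\<integral>x. h x * h x \<partial>m)" .
    have "(\<integral>x. f x + t * h x \<partial>m) = 0"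
      using fin by (simp add: integrable_finite_energy mean_f mean_h)
    from rayleigh_bound[OF min finite_energy_add_scaled[OF weight_nonneg fin] this]
    show "0 \<le> 2 * t * (energy b f h - ?l * (\<integral>x. f x * h x \<partial>m))
        + t\<^sup>2 * (energy b h h - ?l * (\<integral>x. h x * h x \<partial>m))"
      unfolding norm energy_add_scaled[OF weight_nonneg fin] by (simp add: algebra_simps)
  qed
  moreover have "energy b f h = energy b f g"
    unfolding h_def by (rule energy_shift)
  moreover have "(\<integral>x. f x * h x \<partial>m) = (\<integral>x. f x * g x \<partial>m)"
  proof -
    have "(\<integral>x. f x * h x \<partial>m) = (\<integral>x. f x * g x + - (\<integral>x. g x \<partial>m) * f x \<partial>m)"
      by (simp add: h_def algebra_simps)
    also have "\<dots> = (\<integral>x. f x * g x \<partial>m)"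
      using fin(1) g by (simp add: integrable_finite_energy integrable_finite_energy_mult mean_f)
    finally show ?thesis .
  qed
  ultimately show ?thesis by simp
qed

section \<open>Neumann eigenfunctions and the bound on \<lambda>_1\<close>

lemma neumann_form_dom_eq: "neumann_form_dom b m = finite_energy b"
  unfolding neumann_form_dom_def
  using bounded_in_ell2[OF full_support finite_energy_bounded] by blast

lemma finite_energy_in_neumann_space:
  assumes "f \<in> finite_energy b"
  shows "f \<in> neumann_space b m"
  unfolding neumann_space_def neumann_form_dom_eq
  using assms bounded_in_ell2[OF full_support finite_energy_bounded[OF assms]]
  by (auto intro!: bexI[of _ f] simp: ell2_norm_def ell2_inner_def)

text \<open>Functions of finite energy are bounded, hence in \<open>ell2 m\<close>, and multiples of
  \<open>f\<close> lie in \<open>neumann_space\<close>. What remains of the operator is the weak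
  equation tested on all of \<open>finite_energy b\<close>.\<close>

lemma neumann_eigenfunction_iff:
  "neumann_eigenfunction b m \<mu> f \<longleftrightarrow>
     (\<exists>x. f x \<noteq> 0) \<and> f \<in> finite_energy b \<and>
     (\<forall>g \<in> finite_energy b. energy b f g = \<mu> * (\<integral>x. f x * g x \<partial>m))"
proof -
  have "ell2_inner m (\<lambda>x. \<mu> * f x) g = \<mu> * (\<integral>x. f x * g x \<partial>m)"
    if "f \<in> finite_energy b" "g \<in> finite_energy b" for g
    using that
    by (simp add: ell2_inner_eq_integral full_support finite_energy_bounded finite_energy_scale mult.assoc)
  then show ?thesis
    unfolding neumann_eigenfunction_def neumann_operator_def neumann_form_dom_eq
    using finite_energy_in_neumann_space[OF finite_energy_scale, of f \<mu>] by auto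
qed

text \<open>Zero energy forces constancy, so \<kappa> is nonzero; testing the weak equation with 1
  then shows that \<open>h\<close> has mean zero, and the Rayleigh bound applies to it.\<close>

lemma nonconstant_eigenvalue_ge:
  assumes min: "\<And>g. g \<in> unit_mean_zero \<Longrightarrow> l \<le> energy b g g"
    and h: "neumann_eigenfunction b m \<kappa> h" and nonconst: "h x \<noteq> h y"
  shows "l \<le> \<kappa>"
proof -
  have fin: "h \<in> finite_energy b"
    and weak: "\<And>g. g \<in> finite_energy b \<Longrightarrow> energy b h g = \<kappa> * (\<integral>x. h x * g x \<partial>m)"
    and nonzero: "\<exists>x. h x \<noteq> 0"
    using h by (auto simp: neumann_eigenfunction_iff)
  have pos: "0 < (\<integral>x. h x * h x \<partial>m)"
    using nonzero integral_square_pos[OF full_support finite_energy_bounded[OF fin]] by blast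
  have "\<kappa> \<noteq> 0"
    using weak[OF fin] oscillation[OF fin, of x y] nonconst by auto
  moreover have "\<kappa> * (\<integral>x. h x \<partial>m) = 0"
    using weak[OF finite_energy_const, of 1] by (simp add: energy_const_right)
  ultimately have "(\<integral>x. h x \<partial>m) = 0" by simp
  from rayleigh_bound[OF min fin this] weak[OF fin] pos show ?thesis
    by simp
qed

lemma lambda1_ge:
  "4 / ereal D \<le> lambda1 b m"
proof (cases "\<forall>f \<in> finite_energy b. \<exists>c. \<forall>x. f x = c")
  case True
  \<comment> \<open>Here \<open>lambda1\<close> is infinite by definition.\<close>
  then show ?thesis by (simp add: lambda1_def)
next
  case False
  then obtain f0 where "f0 \<in> finite_energy b" "\<nexists>c. \<forall>x. f0 x = c" by blast
  then obtain x y where "f0 \<in> finite_energy b" "f0 x \<noteq> f0 y" by metis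
  then obtain f where f: "f \<in> unit_mean_zero"
    and min: "\<And>g. g \<in> unit_mean_zero \<Longrightarrow> energy b f f \<le> energy b g g"
    using rayleigh_minimizer_exists[OF unit_mean_zero_nonempty] by blast
  define l where "l = energy b f f"
  have fin: "f \<in> finite_energy b" and mean: "(\<integral>x. f x \<partial>m) = 0" and unit: "(\<integral>x. f x * f x \<partial>m) = 1"
    using f by (auto simp: unit_mean_zero_def)
  have nonzero: "\<exists>x. f x \<noteq> 0"
  proof (rule ccontr)
    assume "\<nexists>x. f x \<noteq> 0"
    with unit show False by simp
  qed
  have "(LEAST \<mu>. \<exists>\<nu> f g. \<nu> \<le> \<mu> \<and> neumann_eigenfunction b m \<nu> f \<and>
      neumann_eigenfunction b m \<mu> g \<and> lin_indep2 f g) = l"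
  proof (rule Least_equality)
    \<comment> \<open>The minimum is a candidate: the constants, with eigenvalue 0, are paired with
      the minimizer \<open>f\<close>.\<close>
    have "neumann_eigenfunction b m 0 (\<lambda>_. 1)"
      by (simp add: neumann_eigenfunction_iff finite_energy_const energy_const_left)
    moreover have "neumann_eigenfunction b m l f"
      unfolding neumann_eigenfunction_iff l_def
      using nonzero fin rayleigh_minimizer_weak_eigenfunction[OF f min] by blast
    moreover have "lin_indep2 (\<lambda>_. 1) f"
      unfolding lin_indep2_def
    proof (intro allI impI)
      fix \<alpha> \<beta> :: real
      assume eq: "\<forall>x. \<alpha> * 1 + \<beta> * f x = 0"
      \<comment> \<open>Integration isolates \<alpha>, since \<open>f\<close> has mean zero.\<close>
      then have "(\<integral>x. \<alpha> + \<beta> * f x \<partial>m) = 0" by simp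
      then have "\<alpha> = 0"
        using integrable_finite_energy[OF fin] by (simp add: mean prob_space)
      with eq nonzero show "\<alpha> = 0 \<and> \<beta> = 0" by auto
    qed
    moreover have "0 \<le> l"
      unfolding l_def by (rule energy_nonneg[OF weight_nonneg])
    ultimately show "\<exists>\<nu> f g. \<nu> \<le> l \<and> neumann_eigenfunction b m \<nu> f \<and>
        neumann_eigenfunction b m l g \<and> lin_indep2 f g"
      by blast
  next
    fix \<mu>
    assume "\<exists>\<nu> f g. \<nu> \<le> \<mu> \<and> neumann_eigenfunction b m \<nu> f \<and>
      neumann_eigenfunction b m \<mu> g \<and> lin_indep2 f g"
    then obtain \<nu> g h where gh: "\<nu> \<le> \<mu>" "neumann_eigenfunction b m \<nu> g"
      "neumann_eigenfunction b m \<mu> h" and indep: "lin_indep2 g h" by blast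
    show "l \<le> \<mu>"
    \<comment> \<open>Two independent functions cannot both be constant, and a nonconstant one has
      eigenvalue at least \<open>l\<close>; if it is \<open>g\<close>, use \<nu> \<le>
      \<mu>.\<close>
    proof (cases "\<exists>x y. g x \<noteq> g y \<or> h x \<noteq> h y")
      case True
      with gh show ?thesis
        using nonconstant_eigenvalue_ge[OF min, folded l_def] by (meson order_trans)
    next
      case False
      define c d where "c = g undefined" and "d = h undefined"
      have const: "g = (\<lambda>_. c)" "h = (\<lambda>_. d)"
        using False unfolding c_def d_def by blast+
      have indep: "\<alpha> = 0 \<and> \<beta> = 0" if "\<alpha> * c + \<beta> * d = 0" for \<alpha> \<beta>
        using indep that unfolding lin_indep2_def const by blast
      \<comment> \<open>The coefficients \<open>d\<close> and \<open>- c\<close> give a vanishing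
        combination, so both constants are 0, and then the coefficients 1 and 1 contradict
        independence.\<close>
      have "c = 0" "d = 0"
        using indep[of d "- c"] by (simp_all add: mult.commute)
      then show ?thesis
        using indep[of 1 1] by simp
    qed
  qed
  then have "lambda1 b m = ereal l"
    using False by (simp add: lambda1_def)
  moreover have "4 \<le> D * l"
    using poincare[OF fin mean] by (simp add: unit l_def)
  \<comment> \<open>With \<open>D\<close> positive, the extended quotient is an ordinary real
    one.\<close>
  moreover from this D_nonneg have "D > 0"
    by (cases "D = 0") auto
  ultimately show ?thesis
    using ereal_divide[of D 4] by (simp add: divide_le_eq mult.commute)
qed

end

section \<open>From the oscillation bound to conditions (i)-(iii) and the eigenvalue
  estimate\<close>

theorem corollary3p7:
  fixes b :: "'a::countable \<Rightarrow> 'a \<Rightarrow> real"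
  assumes "weighted_graph b"
    and "connected_graph b"
    and "diam (path_dist b) < \<infinity>"
  shows "(\<exists>c>0. \<forall>f \<in> finite_energy b. (variation f)\<^sup>2 \<le> ereal (c * energy b f f))
    \<and> finite_energy b \<subseteq> {f. bounded (range f)}
    \<and> diam (resistance b) < \<infinity>
    \<and> (\<forall>m :: 'a measure. full_support_prob m \<longrightarrow> 4 / diam (path_dist b) \<le> lambda1 b m)"
proof -
  have nonneg: "\<And>x y. 0 \<le> b x y"
    using assms(1) by (simp add: weighted_graph_def)
  have "0 \<le> diam (path_dist b)"
    unfolding Defs.diam_def using path_dist_nonneg[where b = b, OF nonneg]
    by (meson SUP_upper2 UNIV_I)
  then obtain D where D: "diam (path_dist b) = ereal D" "0 \<le> D"
    using assms(3) by (cases "diam (path_dist b)") auto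
  interpret energy_controls_oscillation b D
    using nonneg D(2) increment_sq_le_diam_mult_energy[OF assms(1) _ D(1)] by unfold_locales auto
  have E: "0 \<le> energy b f f" for f
    by (rule energy_nonneg[OF nonneg])
  \<comment> \<open>The constant in (i) must be positive, whereas \<open>D\<close> may be 0, for
    instance on a single vertex; hence \<open>D + 1\<close>.\<close>
  have "(variation f)\<^sup>2 \<le> ereal ((D + 1) * energy b f f)" if f: "f \<in> finite_energy b" for f
  proof -
    let ?s = "sqrt (D * energy b f f)"
    obtain a where a: "\<And>x. a \<le> f x" "\<And>x. f x \<le> a + ?s"
      using bounded_oscillation_interval[of f, OF oscillation_sqrt[OF f]] by blast
    have "(SUP x. ereal (f x)) \<le> ereal (a + ?s)" "ereal a \<le> (INF x. ereal (f x))"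
      using a by (auto intro!: SUP_least INF_greatest)
    then have "variation f \<le> ereal (a + ?s) - ereal a"
      unfolding variation_def by (rule ereal_minus_mono)
    then have le: "variation f \<le> ereal ?s" by simp
    \<comment> \<open>An upper bound on \<open>variation f\<close> may be squared only once negative
      values are excluded.\<close>
    have "0 \<le> variation f"
    proof -
      have "ereal a \<le> (INF x. ereal (f x))" "(INF x. ereal (f x)) \<le> ereal (f undefined)"
        "ereal (f undefined) \<le> (SUP x. ereal (f x))"
        using a by (auto intro!: INF_greatest INF_lower SUP_upper)
      then show ?thesis
        unfolding variation_def
        by (cases "INF x. ereal (f x)"; cases "SUP x. ereal (f x)") auto
    qed
    with le obtain v where v: "variation f = ereal v" "0 \<le> v" "v \<le> ?s"
      by (cases "variation f") auto
    then have "v\<^sup>2 \<le> ?s\<^sup>2" by (intro power_mono)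
    also have "\<dots> \<le> (D + 1) * energy b f f"
      using D(2) E by (simp add: distrib_right)
    finally show ?thesis by (simp add: v(1))
  qed
  moreover have "diam (resistance b) \<le> ereal D"
    unfolding Defs.diam_def resistance_def
  proof (intro SUP_least)
    fix x y f
    assume f: "f \<in> {f \<in> finite_energy b. energy b f f \<le> 1}"
    then have "D * energy b f f \<le> D * 1"
      using D(2) by (intro mult_left_mono) auto
    with oscillation[of f x y] f show "ereal (\<bar>f x - f y\<bar>\<^sup>2) \<le> ereal D" by auto
  qed
  then have "diam (resistance b) < \<infinity>"
    by (auto simp: less_top[symmetric])
  moreover have "4 / ereal D \<le> lambda1 b m" if "full_support_prob m" for m
  proof -
    interpret energy_controls_oscillation_prob b D m
      using that by unfold_locales
    show ?thesis by (rule lambda1_ge)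
  qed
  ultimately show ?thesis
    unfolding D(1) using finite_energy_bounded D(2) by (intro conjI exI[of _ "D + 1"]) auto
qed

end
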